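(* Let $\langle S,\mathsf{Act},\to\rangle$ be a finite state pLTS, $\mathcal{R}\subseteq S\times S$ a binary relation, and $m$ a $1$-bounded pseudometric on $S$ such that $m(s,t)=0$ if $s\,\mathcal{R}\,t$ and $m(s,t)=1$ otherwise. Then $\mathcal{R}$ is a probabilistic bisimulation if and only if $m$ is a state-metric.
   Context: A pLTS is $\langle S,\mathsf{Act},\to\rangle$ with ${\to}\subseteq S\times\mathsf{Act}\times\mathcal{D}(S)$, $\mathcal{D}(S)$ the probability distributions on $S$. Lifting $\overline{\mathcal{R}}$: the smallest relation on $\mathcal{D}(S)$ with $\overline{s}\,\overline{\mathcal{R}}\,\overline{t}$ whenever $s\mathcal{R}t$ ($\overline{s}$ the point distribution at $s$) and closed under finite convex combinations ($\Delta_i\overline{\mathcal{R}}\Theta_i$, $p_i\geq0$, $\sum p_i=1$ imply $\sum p_i\Delta_i\,\overline{\mathcal{R}}\,\sum p_i\Theta_i$). $\mathcal{R}$ is a probabilistic simulation if $s\mathcal{R}t$ and $s\xrightarrow{a}\Delta$ imply $t\xrightarrow{a}\Theta$ and $\Delta\overline{\mathcal{R}}\Theta$ for some $\Theta$; a probabilistic bisimulation if $\mathcal{R}$ and $\mathcal{R}^{-1}$ are probabilistic simulations. For a $1$-bounded pseudometric $m$ on $S$, $\hat{m}(\Delta,\Theta)$ is the optimal value of: maximize $\sum_{s\in S}(\Delta(s)-\Theta(s))x_s$ subject to $x_s-x_t\leq m(s,t)$ for all $s,t$ and $0\leq x_s\leq1$. $m$ is a state-metric if for all $\epsilon\in[0,1)$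 and $s,t\in S$, $m(s,t)\leq\epsilon$ implies: whenever $s\xrightarrow{a}\Delta$ there is $\Delta'$ with $t\xrightarrow{a}\Delta'$ and $\hat{m}(\Delta,\Delta')\leq\epsilon$. *)

theory Defs
  imports "HOL-Probability.Probability_Mass_Function"
begin

definition dists :: "'s set \<Rightarrow> 's pmf set" where
  "dists S = {\<Delta>. set_pmf \<Delta> \<subseteq> S}"

definition plts :: "'s set \<Rightarrow> 'a set \<Rightarrow> ('s \<times> 'a \<times> 's pmf) set \<Rightarrow> bool" where
  "plts S Act tr \<longleftrightarrow> tr \<subseteq> S \<times> Act \<times> dists S"

(* In the rule convex, the convex combinations of the D i and of the T i are written
   pointwise on probability mass functions. If R is a relation on S, so that the points lie
   in S, then the lifting is a relation on dists S. *)
inductive_set lifting :: "('s \<times> 's) set \<Rightarrow> ('s pmf \<times> 's pmf) set" for R :: "('s \<times> 's) set" where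
  point: "(s, t) \<in> R \<Longrightarrow> (return_pmf s, return_pmf t) \<in> lifting R"
| convex: "(\<And>i::nat. i < n \<Longrightarrow> (D i, T i) \<in> lifting R) \<Longrightarrow>
    (\<And>i. i < n \<Longrightarrow> 0 \<le> p i) \<Longrightarrow> (\<Sum>i<n. p i) = (1::real) \<Longrightarrow>
    (\<And>s. pmf \<Delta> s = (\<Sum>i<n. p i * pmf (D i) s)) \<Longrightarrow>
    (\<And>s. pmf \<Theta> s = (\<Sum>i<n. p i * pmf (T i) s)) \<Longrightarrow>
    (\<Delta>, \<Theta>) \<in> lifting R"

definition prob_simulation :: "('s \<times> 'a \<times> 's pmf) set \<Rightarrow> ('s \<times> 's) set \<Rightarrow> bool" where
  "prob_simulation tr R \<longleftrightarrow>
    (\<forall>s t a \<Delta>. (s, t) \<in> R \<longrightarrow> (s, a, \<Delta>) \<in> tr \<longrightarrow>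
      (\<exists>\<Theta>. (t, a, \<Theta>) \<in> tr \<and> (\<Delta>, \<Theta>) \<in> lifting R))"

definition prob_bisimulation :: "('s \<times> 'a \<times> 's pmf) set \<Rightarrow> ('s \<times> 's) set \<Rightarrow> bool" where
  "prob_bisimulation tr R \<longleftrightarrow> prob_simulation tr R \<and> prob_simulation tr (R\<inverse>)"

definition pseudometric1 :: "'s set \<Rightarrow> ('s \<Rightarrow> 's \<Rightarrow> real) \<Rightarrow> bool" where
  "pseudometric1 S m \<longleftrightarrow>
    (\<forall>s\<in>S. \<forall>t\<in>S. 0 \<le> m s t \<and> m s t \<le> 1) \<and>
    (\<forall>s\<in>S. m s s = 0) \<and>
    (\<forall>s\<in>S. \<forall>t\<in>S. m s t = m t s) \<and>
    (\<forall>s\<in>S. \<forall>t\<in>S. \<forall>u\<in>S. m s u \<le> m s t + m t u)"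

(* The optimal value of the linear program: for finite S and a 1-bounded pseudometric the
   objective values form a nonempty bounded set, so the real supremum is meaningful, and the
   maximum is attained because the feasible region is compact. *)
definition dist_lift :: "'s set \<Rightarrow> ('s \<Rightarrow> 's \<Rightarrow> real) \<Rightarrow> 's pmf \<Rightarrow> 's pmf \<Rightarrow> real" where
  "dist_lift S m \<Delta> \<Theta> =
    Sup {\<Sum>s\<in>S. (pmf \<Delta> s - pmf \<Theta> s) * x s | x.
      (\<forall>s\<in>S. \<forall>t\<in>S. x s - x t \<le> m s t) \<and> (\<forall>s\<in>S. 0 \<le> x s \<and> x s \<le> 1)}"

definition state_metric ::
    "'s set \<Rightarrow> ('s \<times> 'a \<times> 's pmf) set \<Rightarrow> ('s \<Rightarrow> 's \<Rightarrow> real) \<Rightarrow> bool" where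
  "state_metric S tr m \<longleftrightarrow> pseudometric1 S m \<and>
    (\<forall>\<epsilon>. 0 \<le> \<epsilon> \<and> \<epsilon> < 1 \<longrightarrow>
      (\<forall>s\<in>S. \<forall>t\<in>S. m s t \<le> \<epsilon> \<longrightarrow>
        (\<forall>a \<Delta>. (s, a, \<Delta>) \<in> tr \<longrightarrow>
          (\<exists>\<Delta>'. (t, a, \<Delta>') \<in> tr \<and> dist_lift S m \<Delta> \<Delta>' \<le> \<epsilon>))))"

end

theory Submission imports Defs begin

text \<open>
  For a $0/1$-valued pseudometric, being a state-metric reduces to the case $\epsilon = 0$, so
  everything rests on the equivalence of \<open>\<Delta>\<close> and \<open>\<Theta>\<close> being related by the lifting and
  \<open>\<Delta>\<close>, \<open>\<Theta>\<close> having lifted distance at most $0$. Feasible points of the linear program are constant on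
  \<open>R\<close>-classes, so the objective vanishes on point pairs and, by linearity, on the lifting.
  Conversely the indicators of \<open>R\<close>-closed sets and of their complements are feasible, so distance
  at most $0$ forces \<open>\<Delta>\<close> and \<open>\<Theta>\<close> to agree on all \<open>R\<close>-classes. This yields a coupling supported
  on \<open>R\<close>, which exhibits the pair as a convex combination of point pairs.
\<close>

lemma sum_pmf_return:
  assumes "finite S" "a \<in> S"
  shows "(\<Sum>s\<in>S. pmf (return_pmf a) s * f s) = f a"
proof -
  have "(\<Sum>s\<in>S. pmf (return_pmf a) s * f s) = (\<Sum>s\<in>S. if s = a then f s else 0)"
    by (intro sum.cong) (auto simp: pmf_return)
  then show ?thesis
    using assms by simp
qed

text \<open>Induction on the lifting. For point masses the objective is \<open>x s - x t\<close>. It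
  is linear in the pair of distributions, so a combination with nonnegative weights preserves the
  sign.\<close>

lemma lifting_objective_le_0:
  assumes "(\<Delta>, \<Theta>) \<in> lifting R" "finite S" "R \<subseteq> S \<times> S"
    and x: "\<And>s t. (s, t) \<in> R \<Longrightarrow> x s - x t \<le> (0::real)"
  shows "(\<Sum>s\<in>S. (pmf \<Delta> s - pmf \<Theta> s) * x s) \<le> 0"
  using assms(1)
proof (induction rule: lifting.induct)
  case (point s t)
  then have "s \<in> S" "t \<in> S"
    using assms(3) by auto
  then show ?case
    unfolding left_diff_distrib sum_subtractf
    using x[OF point] sum_pmf_return[OF assms(2), of _ x] by simp
next
  case (convex n D T p \<Delta> \<Theta>)
  have "(\<Sum>s\<in>S. (pmf \<Delta> s - pmf \<Theta> s) * x s)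
      = (\<Sum>s\<in>S. \<Sum>i<n. p i * ((pmf (D i) s - pmf (T i) s) * x s))"
    by (simp add: convex.hyps algebra_simps sum_subtractf sum_distrib_left sum_distrib_right)
  also have "\<dots> = (\<Sum>i<n. p i * (\<Sum>s\<in>S. (pmf (D i) s - pmf (T i) s) * x s))"
    by (subst sum.swap) (simp add: sum_distrib_left)
  also have "\<dots> \<le> 0"
    using convex.IH convex.hyps(2) by (auto intro: sum_nonpos[OF mult_nonneg_nonpos])
  finally show ?case .
qed

text \<open>A joint distribution supported on \<open>R\<close> is the mixture of the point masses at
  the pairs \<open>z\<close> in \<open>R\<close> with weights \<open>pmf pq z\<close>. Taking both
  marginals gives an instance of \<open>lifting.convex\<close>.\<close>

lemma coupling_in_lifting:
  assumes "finite R" "set_pmf pq \<subseteq> R"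
  shows "(map_pmf fst pq, map_pmf snd pq) \<in> lifting R"
proof -
  \<comment> \<open>The rule \<open>lifting.convex\<close> indexes its summands by naturals below
    \<open>n\<close>, so \<open>R\<close> is enumerated.\<close>
  obtain e where e: "bij_betw e {..<card R} R"
    using ex_bij_betw_nat_finite[OF assms(1)] by (auto simp: atLeast0LessThan)
  have marginal: "pmf (map_pmf f pq) s = (\<Sum>i<card R. pmf pq (e i) * pmf (return_pmf (f (e i))) s)"
    for f :: "'a \<times> 'a \<Rightarrow> 'a" and s
  proof -
    have "pmf (map_pmf f pq) s = (\<Sum>z\<in>R. pmf pq z * pmf (return_pmf (f z)) s)"
      unfolding map_pmf_def pmf_bind using assms
      by (subst integral_measure_pmf_real[of R]) (auto simp: mult.commute)
    then show ?thesis
      by (simp add: sum.reindex_bij_betw[OF e, symmetric])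
  qed
  show ?thesis
  proof (rule lifting.convex[where n = "card R" and p = "\<lambda>i. pmf pq (e i)"])
    show "(return_pmf (fst (e i)), return_pmf (snd (e i))) \<in> lifting R" if "i < card R" for i
      using bij_betw_apply[OF e, of i] that by (intro lifting.point) simp
    show "(\<Sum>i<card R. pmf pq (e i)) = 1"
      using sum_pmf_eq_1[OF assms] by (simp add: sum.reindex_bij_betw[OF e])
  qed (use marginal in auto)
qed

text \<open>For an equivalence, \<open>rel_pmf_iff_equivp\<close> turns agreement on classes into
  the existence of a coupling.\<close>

lemma lifting_if_measure_eq:
  assumes "finite S" "equiv S R" "set_pmf \<Delta> \<subseteq> S" "set_pmf \<Theta> \<subseteq> S"
    and eq: "\<And>C. (\<And>s t. (s, t) \<in> R \<Longrightarrow> s \<in> C \<longleftrightarrow> t \<in> C) \<Longrightarrow>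
      measure_pmf.prob \<Delta> C = measure_pmf.prob \<Theta> C"
  shows "(\<Delta>, \<Theta>) \<in> lifting R"
proof -
  have R: "R \<subseteq> S \<times> S" "refl_on S R" "sym R" "trans R"
    using assms(2) by (auto simp: equiv_def)
  \<comment> \<open>\<open>rel_pmf_iff_equivp\<close> needs an equivalence on the whole type, so
    \<open>R\<close> is extended by equality outside \<open>S\<close>.\<close>
  define Q where "Q = (\<lambda>x y. x = y \<or> (x, y) \<in> R)"
  have "equivp Q"
    using R by (intro equivpI reflpI sympI transpI) (auto simp: Q_def dest: symD transD)
  have "rel_pmf Q \<Delta> \<Theta>"
    unfolding rel_pmf_iff_equivp[OF \<open>equivp Q\<close>]
  proof
    fix C assume "C \<in> UNIV // {(x, y). Q x y}"
    then obtain a where "C = {y. Q a y}"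
      by (auto simp: quotient_def)
    then have "s \<in> C \<longleftrightarrow> t \<in> C" if "(s, t) \<in> R" for s t
      using that R by (auto simp: Q_def dest: symD transD)
    then show "measure_pmf.prob \<Delta> C = measure_pmf.prob \<Theta> C"
      by (rule eq)
  qed
  then obtain pq where pq: "\<And>x y. (x, y) \<in> set_pmf pq \<Longrightarrow> Q x y"
      and marginals: "map_pmf fst pq = \<Delta>" "map_pmf snd pq = \<Theta>"
    by (auto elim!: rel_pmf.cases)
  \<comment> \<open>The pairs added in \<open>Q\<close> get no mass: first components lie in the
    support of \<open>\<Delta>\<close>, hence in \<open>S\<close>, where \<open>R\<close> is
    reflexive.\<close>
  have "set_pmf pq \<subseteq> R"
  proof (rule subrelI)
    fix x y assume xy: "(x, y) \<in> set_pmf pq"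
    then have "x \<in> set_pmf \<Delta>"
      using marginals(1) by force
    then show "(x, y) \<in> R"
      using pq[OF xy] assms(3) R(2) by (auto simp: Q_def refl_on_def)
  qed
  moreover have "finite R"
    using R(1) assms(1) by (meson finite_SigmaI finite_subset)
  ultimately show ?thesis
    using coupling_in_lifting marginals by blast
qed

text \<open>A real supremum bounds its elements only if the set is bounded above. Since
  \<open>0 \<le> y s \<le> 1\<close>, the sum of the
  \<open>\<bar>pmf \<Delta> s - pmf \<Theta> s\<bar>\<close> is such a bound.\<close>

lemma objective_le_dist_lift:
  assumes "\<And>s t. s \<in> S \<Longrightarrow> t \<in> S \<Longrightarrow> x s - x t \<le> m s t"
    and "\<And>s. s \<in> S \<Longrightarrow> 0 \<le> x s \<and> x s \<le> 1"
  shows "(\<Sum>s\<in>S. (pmf \<Delta> s - pmf \<Theta> s) * x s) \<le> dist_lift S m \<Delta> \<Theta>"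
  unfolding dist_lift_def
proof (rule cSup_upper)
  have "(\<Sum>s\<in>S. (pmf \<Delta> s - pmf \<Theta> s) * y s) \<le> (\<Sum>s\<in>S. \<bar>pmf \<Delta> s - pmf \<Theta> s\<bar>)"
    if "\<forall>s\<in>S. 0 \<le> y s \<and> y s \<le> 1" for y
  proof (rule sum_mono)
    fix s assume "s \<in> S"
    then have "\<bar>pmf \<Delta> s - pmf \<Theta> s\<bar> * \<bar>y s\<bar> \<le> \<bar>pmf \<Delta> s - pmf \<Theta> s\<bar> * 1"
      using that by (intro mult_left_mono) auto
    then show "(pmf \<Delta> s - pmf \<Theta> s) * y s \<le> \<bar>pmf \<Delta> s - pmf \<Theta> s\<bar>"
      by (metis abs_ge_self abs_mult mult.right_neutral order_trans)
  qed
  then show "bdd_above {\<Sum>s\<in>S. (pmf \<Delta> s - pmf \<Theta> s) * x s | x.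
      (\<forall>s\<in>S. \<forall>t\<in>S. x s - x t \<le> m s t) \<and> (\<forall>s\<in>S. 0 \<le> x s \<and> x s \<le> 1)}"
    unfolding bdd_above_def by blast
qed (use assms in blast)

lemma sum_pmf_indicator:
  assumes "finite S" "set_pmf \<Delta> \<subseteq> S"
  shows "(\<Sum>s\<in>S. pmf \<Delta> s * indicator C s) = measure_pmf.prob \<Delta> C"
proof -
  have "measure_pmf.prob \<Delta> C = measure_pmf.expectation \<Delta> (indicator C)"
    by simp
  also have "\<dots> = (\<Sum>s\<in>S. pmf \<Delta> s * indicator C s)"
    using assms by (subst integral_measure_pmf_real[of S]) (auto simp: mult.commute)
  finally show ?thesis ..
qed

lemma lifting_iff_dist_lift_le_0:
  assumes "finite S" "equiv S R" "set_pmf \<Delta> \<subseteq> S" "set_pmf \<Theta> \<subseteq> S"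
    and m: "\<And>s t. s \<in> S \<Longrightarrow> t \<in> S \<Longrightarrow> m s t = (if (s, t) \<in> R then 0 else 1)"
  shows "(\<Delta>, \<Theta>) \<in> lifting R \<longleftrightarrow> dist_lift S m \<Delta> \<Theta> \<le> 0"
proof
  have R: "R \<subseteq> S \<times> S"
    using assms(2) by (auto simp: equiv_def)
  {
    assume lift: "(\<Delta>, \<Theta>) \<in> lifting R"
    show "dist_lift S m \<Delta> \<Theta> \<le> 0"
      unfolding dist_lift_def
    proof (rule cSup_least)
      \<comment> \<open>\<open>cSup_least\<close> requires a nonempty set; the zero vector is
        feasible.\<close>
      have "\<exists>x. (\<forall>s\<in>S. \<forall>t\<in>S. x s - x t \<le> m s t) \<and> (\<forall>s\<in>S. (0::real) \<le> x s \<and> x s \<le> 1)"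
        using m by (intro exI[of _ "\<lambda>_. 0"]) simp
      then show "{\<Sum>s\<in>S. (pmf \<Delta> s - pmf \<Theta> s) * x s | x.
          (\<forall>s\<in>S. \<forall>t\<in>S. x s - x t \<le> m s t) \<and> (\<forall>s\<in>S. 0 \<le> x s \<and> x s \<le> 1)} \<noteq> {}"
        by blast
    next
      fix v assume "v \<in> {\<Sum>s\<in>S. (pmf \<Delta> s - pmf \<Theta> s) * x s | x.
          (\<forall>s\<in>S. \<forall>t\<in>S. x s - x t \<le> m s t) \<and> (\<forall>s\<in>S. 0 \<le> x s \<and> x s \<le> 1)}"
      then obtain x where v: "v = (\<Sum>s\<in>S. (pmf \<Delta> s - pmf \<Theta> s) * x s)"
          and x: "\<forall>s\<in>S. \<forall>t\<in>S. x s - x t \<le> m s t"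
        by blast
      have "x s - x t \<le> 0" if "(s, t) \<in> R" for s t
        using x m[of s t] that R by fastforce
      then show "v \<le> 0"
        unfolding v by (rule lifting_objective_le_0[OF lift assms(1) R])
    qed
  next
    assume dist: "dist_lift S m \<Delta> \<Theta> \<le> 0"
    have le: "measure_pmf.prob \<Delta> C \<le> measure_pmf.prob \<Theta> C"
      if C: "\<And>s t. (s, t) \<in> R \<Longrightarrow> s \<in> C \<longleftrightarrow> t \<in> C" for C
    proof -
      have "measure_pmf.prob \<Delta> C - measure_pmf.prob \<Theta> C
          = (\<Sum>s\<in>S. (pmf \<Delta> s - pmf \<Theta> s) * indicator C s)"
        unfolding left_diff_distrib sum_subtractf
          sum_pmf_indicator[OF assms(1,3)] sum_pmf_indicator[OF assms(1,4)] ..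
      \<comment> \<open>The indicator of \<open>C\<close> is feasible: it is constant along
        \<open>R\<close>, and other pairs have distance 1.\<close>
      also have "\<dots> \<le> dist_lift S m \<Delta> \<Theta>"
        using C m by (intro objective_le_dist_lift) (auto simp: indicator_def)
      finally show ?thesis
        using dist by simp
    qed
    show "(\<Delta>, \<Theta>) \<in> lifting R"
    proof (rule lifting_if_measure_eq[OF assms(1-4)])
      fix C assume C: "\<And>s t. (s, t) \<in> R \<Longrightarrow> s \<in> C \<longleftrightarrow> t \<in> C"
      \<comment> \<open>The complement is also closed under \<open>R\<close>, and total mass is 1,
        so this gives the reverse inequality for \<open>C\<close>.\<close>
      have "measure_pmf.prob \<Delta> (- C) \<le> measure_pmf.prob \<Theta> (- C)"
        using C by (intro le) auto
      then show "measure_pmf.prob \<Delta> C = measure_pmf.prob \<Theta> C"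
        using le[OF C] measure_pmf.prob_compl[of C \<Delta>] measure_pmf.prob_compl[of C \<Theta>]
        by (simp add: Compl_eq_Diff_UNIV)
    qed
  }
qed

text \<open>\<open>R\<close> is the zero set of \<open>m\<close> on \<open>S\<close>, so the
  pseudometric axioms become the equivalence laws; transitivity is the triangle inequality with both
  summands 0.\<close>

lemma equiv_if_pseudometric1:
  assumes "R \<subseteq> S \<times> S" "pseudometric1 S m"
    and m: "\<And>s t. s \<in> S \<Longrightarrow> t \<in> S \<Longrightarrow> m s t = (if (s, t) \<in> R then 0 else 1)"
  shows "equiv S R"
proof (rule equivI)
  have pm: "m s s = 0" "m s t = m t s" "m s u \<le> m s t + m t u"
    if "s \<in> S" "t \<in> S" "u \<in> S" for s t u
    using assms(2) that by (auto simp: pseudometric1_def)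
  show "refl_on S R"
    using pm(1) m by (metis refl_onI zero_neq_one)
  show "sym R"
  proof (rule symI)
    fix s t assume "(s, t) \<in> R"
    then show "(t, s) \<in> R"
      using pm(2)[of s t s] m[of s t] m[of t s] assms(1) by (auto split: if_splits)
  qed
  show "trans R"
  proof (rule transI)
    fix s t u assume "(s, t) \<in> R" "(t, u) \<in> R"
    moreover from this have "s \<in> S" "t \<in> S" "u \<in> S"
      using assms(1) by auto
    ultimately show "(s, u) \<in> R"
      using pm(3)[of s t u] m[of s t] m[of t u] m[of s u] by (auto split: if_splits)
  qed
qed (use assms(1) in auto)

theorem theorem6p9:
  fixes S :: "'s set" and Act :: "'a set" and tr :: "('s \<times> 'a \<times> 's pmf) set"
    and R :: "('s \<times> 's) set" and m :: "'s \<Rightarrow> 's \<Rightarrow> real"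
  assumes "finite S"
    and "plts S Act tr"
    and "R \<subseteq> S \<times> S"
    and "pseudometric1 S m"
    and "\<And>s t. s \<in> S \<Longrightarrow> t \<in> S \<Longrightarrow> m s t = (if (s, t) \<in> R then 0 else 1)"
  shows "prob_bisimulation tr R \<longleftrightarrow> state_metric S tr m"
proof -
  have R: "equiv S R"
    using assms(3-5) by (rule equiv_if_pseudometric1)
  \<comment> \<open>By symmetry of \<open>R\<close>, both halves of bisimulation coincide.\<close>
  then have "R\<inverse> = R"
    by (simp add: equiv_def sym_conv_converse_eq)
  then have "prob_bisimulation tr R \<longleftrightarrow> prob_simulation tr R"
    by (simp add: prob_bisimulation_def)
  moreover have lift: "(\<Delta>, \<Theta>) \<in> lifting R \<longleftrightarrow> dist_lift S m \<Delta> \<Theta> \<le> 0"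
    if "(s, a, \<Delta>) \<in> tr" "(t, b, \<Theta>) \<in> tr" for s t a b \<Delta> \<Theta>
    using that assms(2) by (intro lifting_iff_dist_lift_le_0[OF assms(1) R _ _ assms(5)])
      (auto simp: plts_def dists_def)
  moreover have "prob_simulation tr R \<longleftrightarrow> state_metric S tr m"
  proof
    assume sim: "prob_simulation tr R"
    show "state_metric S tr m"
      unfolding state_metric_def
    proof (intro conjI assms(4) allI impI ballI)
      fix \<epsilon> :: real and s t a \<Delta>
      assume *: "0 \<le> \<epsilon> \<and> \<epsilon> < 1" "s \<in> S" "t \<in> S" "m s t \<le> \<epsilon>" "(s, a, \<Delta>) \<in> tr"
      \<comment> \<open>As \<open>m\<close> takes only the values 0 and 1,
        \<open>\<epsilon> < 1\<close> forces \<open>m s t = 0\<close>.\<close>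
      then have "(s, t) \<in> R"
        using assms(5)[of s t] by (auto split: if_splits)
      then obtain \<Theta> where \<Theta>: "(t, a, \<Theta>) \<in> tr" "(\<Delta>, \<Theta>) \<in> lifting R"
        using sim *(5) unfolding prob_simulation_def by blast
      then have "dist_lift S m \<Delta> \<Theta> \<le> \<epsilon>"
        using lift[OF *(5) \<Theta>(1)] *(1) by linarith
      then show "\<exists>\<Delta>'. (t, a, \<Delta>') \<in> tr \<and> dist_lift S m \<Delta> \<Delta>' \<le> \<epsilon>"
        using \<Theta>(1) by blast
    qed
  next
    assume sm: "state_metric S tr m"
    show "prob_simulation tr R"
      unfolding prob_simulation_def
    proof (intro allI impI)
      fix s t a \<Delta> assume *: "(s, t) \<in> R" "(s, a, \<Delta>) \<in> tr"
      then have "s \<in> S" "t \<in> S" "m s t \<le> 0"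
        using assms(3) assms(5)[of s t] by auto
      \<comment> \<open>The state-metric condition is instantiated at
        \<open>\<epsilon> = 0\<close>.\<close>
      moreover have "(0::real) \<le> 0 \<and> (0::real) < 1"
        by simp
      ultimately obtain \<Theta> where "(t, a, \<Theta>) \<in> tr" "dist_lift S m \<Delta> \<Theta> \<le> 0"
        using sm *(2) unfolding state_metric_def by blast
      then show "\<exists>\<Theta>. (t, a, \<Theta>) \<in> tr \<and> (\<Delta>, \<Theta>) \<in> lifting R"
        using lift[OF *(2)] by blast
    qed
  qed
  ultimately show ?thesis
    by simp
qed

end
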